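(* Let $\mathcal{C}$ be a context of verification, $p$ a protocol, $F$ a $\mathcal{C}$-reliable function whose associated selection is an instance of the class $S_{Gen}^{EK}$, and let $\mathcal{W}_{p,F}$ be the corresponding Witness-Function inside the protection of an external key. Let $m\in\mathcal{M}_p^{\mathcal{G}}$. Then for all $\sigma\in\Gamma$ and all $\alpha\in\mathcal{A}(\mathcal{M}_p)$, $$F(\alpha,\partial[\overline{\alpha}]m)\;\sqsupseteq\;\mathcal{W}_{p,F}(\alpha,m\sigma)\;\sqsupseteq\;\underset{\overset{m'\in\mathcal{M}_p^{\mathcal{G}}}{\exists\sigma'\in\Gamma.\,m'\sigma'=m\sigma'}}{\sqcap}F(\alpha,\partial[\overline{\alpha}]m'\sigma').$$
   Context: **Context of verification.** $\mathcal{C}=\langle\mathcal{M},\xi,\models,\mathcal{K},\mathcal{L}^{\sqsupseteq},\ulcorner\cdot\urcorner\rangle$, where: $\mathcal{M}=T_{\langle\mathcal{N},\Sigma\rangle}(\mathcal{X})$ is the set of messages (terms) built from atomic names $\mathcal{N}$ (nonces, keys, principals, ...), function symbols $\Sigma$ (encryption, decryption, concatenation, ...) and variables $\mathcal{X}$; $\mathcal{A}$ is the set of atomic messages, $\mathcal{A}(m)$ (resp. $\mathcal{A}(M)$) the set of atoms of a message $m$ (resp. of a set $M$ of messages); $\mathcal{I}$ is the set of principal identities, including the intruder $I$; $k^{-1}$ is the reverse of key $k$. $\xi$ is an equational theory on messages. $\mathcal{K}$ assigns to each agent her initial knowledge; $K(I)$ is that of the intruder. $M\models_{\mathcal{C}}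 m$ means that the intruder can infer $m$ from $M\cup K(I)$ by applying functions of $\Sigma$ modulo $\xi$. $\mathcal{L}^{\sqsupseteq}=(\mathcal{L},\sqsupseteq,\sqcup,\sqcap,\bot,\top)$ is a lattice of security levels, here $(2^{\mathcal{I}},\subseteq,\cap,\cup,\mathcal{I},\emptyset)$ (so $a\sqsupseteq b$ means $a\subseteq b$, $\sqcap$ is $\cup$, $\bot=\mathcal{I}$, $\top=\emptyset$). $\ulcorner\cdot\urcorner$ is a partial function from messages to security levels; $\ulcorner M\urcorner\sqsupseteq\ulcorner m\urcorner$ means that there is $m'\in M$ with $\ulcorner m'\urcorner\sqsupseteq\ulcorner m\urcorner$. **Protocols.** A protocol $p$ is given by a finite set $R_G(p)$ of generalized roles (sequences of sending/receiving steps of one honest agent, in which messages that the agent cannot verify are replaced by variables). $\mathcal{M}_p^{\mathcal{G}}$ is the finite set of messages with variables occurring in $R_G(p)$ (variables of distinct messages renamed apart); $\mathcal{M}_p$ is the set of closed messages obtained from it by substitution; $\Gamma$ is the set of substitutions ($m\sigma$ is taken to be a closed message). **Reliable functions.** A function $F$ maps an atom and a set of messages to $\mathcal{L}$; $F(\alpha,m)=F(\alpha,\{m\})$. It is well-formed if $F(\alpha,\{\alpha\})=\bot$, $F(\alpha,M_1\cup M_2)=F(\alpha,M_1)\sqcap F(\alpha,M_2)$, and $F(\alpha,M)=\top$ when $\alpha\notin\mathcal{A}(M)$. It is full-invariant-by-intruder if $M\models_{\mathcal{C}} m$ implies that for all $\alpha\in\mathcal{A}(m)$, $F(\alpha,m)\sqsupseteq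 F(\alpha,M)$ or $\ulcorner K(I)\urcorner\sqsupseteq\ulcorner\alpha\urcorner$. It is $\mathcal{C}$-reliable if it is both. **Selections.** $\mathcal{E}_{\mathcal{C}}$ denotes the encryption functions, $\overline{\mathcal{E}}_{\mathcal{C}}$ the other (non-encryption) functions, and $m_\Downarrow$ the normal form of $m$ for the rewriting system orienting $\xi$. $S_{Gen}^{EK}$ is the class of selections $S$ (maps from an atom and a message or set of messages to $2^{\mathcal{A}}$) with: $S(\alpha,\alpha)=\mathcal{A}$; $S(\alpha,m)=\emptyset$ if $\alpha\notin\mathcal{A}(m)$; for $\alpha\in\mathcal{A}(m)$: if $m=f_k(m_1,\dots,m_n)=m_\Downarrow$, $f_k\in\mathcal{E}_{\mathcal{C}}$ and $\ulcorner k^{-1}\urcorner\sqsupseteq\ulcorner\alpha\urcorner$ then $S(\alpha,m)\subseteq(\bigcup_i\mathcal{A}(m_i)\cup\{k^{-1}\})\setminus\{\alpha\}$; if $m=f_k(m_1,\dots,m_n)=m_\Downarrow$, $f_k\in\mathcal{E}_{\mathcal{C}}$ and $\ulcorner k^{-1}\urcorner\not\sqsupseteq\ulcorner\alpha\urcorner$, or if $m=f(m_1,\dots,m_n)=m_\Downarrow$ with $f\in\overline{\mathcal{E}}_{\mathcal{C}}$, then $S(\alpha,m)=\bigcup_i S(\alpha,m_i)$; if $m\neq m_\Downarrow$ then $S(\alpha,m)=S(\alpha,m_\Downarrow)$; and $S(\alpha,\{m\}\cup M)=S(\alpha,m)\cup S(\alpha,M)$. A function $F$ has associated selection $S$ if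 $F=\psi\circ S$, where $\psi(M)=\top$ if $M=\emptyset$ and $\psi(M)=\sqcap_{\beta\in M}\psi(\beta)$ otherwise, with $\psi(\beta)=\{\beta\}$ if $\beta\in\mathcal{I}$ and $\psi(\beta)=\ulcorner\beta\urcorner$ otherwise. **Derivation.** $\partial_X$ erases the variable $X$: $\partial_X\epsilon=\epsilon$ (empty message), $\partial_X\beta=\beta$ for atoms $\beta$, $\partial_XX=\epsilon$, $\partial_XY=Y$ for $Y\neq X$, $\partial_X$ commutes with all function symbols, and $\partial_{S_1\cup S_2}m=\partial_{S_1}\partial_{S_2}m$. $\partial m$ erases all variables of $m$; $\partial[\overline{X}]m$ erases all variables of $m$ except $X$, which is then treated as a constant. For $m\in\mathcal{M}_p^{\mathcal{G}}$, $\sigma\in\Gamma$ and $\alpha\in\mathcal{A}(m\sigma)$, $$F(\alpha,\partial[\overline{\alpha}]m\sigma)=\begin{cases}F(\alpha,\partial m)&\text{if }\alpha\in\mathcal{A}(\partial m),\\ F(X,\partial[\overline{X}]m)&\text{if }\alpha=X\sigma\text{ and }\alpha\notin\mathcal{A}(\partial m),\end{cases}$$ where "$\alpha=X\sigma$" covers any component that is not an atom of the static part $\partial m$ and comes from the substitution of the variable $X$ of $m$ (treated as a block, as $X$ itself); the value is $\top$ if $\alpha$ does not occur in $m\sigma$. This value depends only on the static part of $m$, and $F(\alpha,\partial[\overline{\alpha}]m)$ denotes it. **Witness-Function.** For $m\in\mathcal{M}_p^{\mathcal{G}}$, $m\sigma$ closed and $\alpha\in\mathcal{A}(m\sigma)$,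 $$\mathcal{W}_{p,F}(\alpha,m\sigma)=\underset{\overset{m'\in\mathcal{M}_p^{\mathcal{G}}}{\exists\sigma'\in\Gamma.\,m'\sigma'=m\sigma}}{\sqcap}F(\alpha,\partial[\overline{\alpha}]m'\sigma').$$ It is "inside the protection of an external key" when $F$ is a function whose associated selection is in $S_{Gen}^{EK}$. Note the difference of the index sets: $m'\sigma'=m\sigma$ (sources of the given closed message $m\sigma$) in $\mathcal{W}_{p,F}$, and $m'\sigma'=m\sigma'$ (messages unifiable with $m$, with unifier $\sigma'$) in the lower bound. *)

theory Defs
  imports Main
begin

section \<open>Messages\<close>

datatype (dead 'n, dead 'f, vars: 'x) msg =
    Name 'n
  | Var 'x
  | Empty
  | Fun 'f "('n, 'f, 'x) msg list"

text \<open>Variables count as atoms: the derivation below keeps a variable \<open>X\<close> in order to treat it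
  as a constant, and reliable functions are then applied to the atom \<open>X\<close>.  On closed messages
  \<open>atoms\<close> contains names only.\<close>

definition atomics :: "('n, 'f, 'x) msg set" where
  "atomics = range Name \<union> range Var"

primrec atoms :: "('n, 'f, 'x) msg \<Rightarrow> ('n, 'f, 'x) msg set" where
  "atoms (Name a) = {Name a}"
| "atoms (Var x) = {Var x}"
| "atoms Empty = {}"
| "atoms (Fun f ts) = \<Union> (set (map atoms ts))"

definition atoms_of :: "('n, 'f, 'x) msg set \<Rightarrow> ('n, 'f, 'x) msg set" where
  "atoms_of M = (\<Union>m\<in>M. atoms m)"

definition closed_msg :: "('n, 'f, 'x) msg \<Rightarrow> bool" where
  "closed_msg m \<longleftrightarrow> vars m = {}"

primrec subst :: "('x \<Rightarrow> ('n, 'f, 'x) msg) \<Rightarrow> ('n, 'f, 'x) msg \<Rightarrow> ('n, 'f, 'x) msg" where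
  "subst \<sigma> (Name a) = Name a"
| "subst \<sigma> (Var x) = \<sigma> x"
| "subst \<sigma> Empty = Empty"
| "subst \<sigma> (Fun f ts) = Fun f (map (subst \<sigma>) ts)"


section \<open>Security levels\<close>

text \<open>The lattice \<open>(2\<^sup>I, \<subseteq>, \<inter>, \<union>, I, \<emptyset>)\<close> with the identities \<open>I\<close> as its least secure element:
  \<open>sec_geq a b\<close> reads ``\<open>a\<close> is at least as secure as \<open>b\<close>'', and the (arbitrary) meet is union.\<close>

definition sec_geq :: "'n set \<Rightarrow> 'n set \<Rightarrow> bool"  (infix "\<sqsupseteq>\<^sub>s" 50) where
  "a \<sqsupseteq>\<^sub>s b \<longleftrightarrow> a \<subseteq> b"

definition sec_meet :: "'n set set \<Rightarrow> 'n set" where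
  "sec_meet L = \<Union> L"

definition sec_top :: "'n set" where
  "sec_top = {}"

lemma sec_meet_empty: "sec_meet {} = sec_top"
  by (simp add: sec_meet_def sec_top_def)


section \<open>Contexts of verification\<close>

text \<open>An encryption \<open>f\<^sub>k(m\<^sub>1, \<dots>, m\<^sub>n)\<close> is the term \<open>Fun f (k # [m\<^sub>1, \<dots>, m\<^sub>n])\<close> with
  \<open>f \<in> encs C\<close>: the first argument of an encryption symbol is the key.
  \<open>rules\<close> is the rewriting system that orients the equations \<open>eqs\<close>.
  \<open>level\<close> is partial: \<open>None\<close> stands for an undefined level.\<close>

record ('n, 'f, 'x) verif_ctx =
  arity :: "'f \<Rightarrow> nat"
  encs :: "'f set"
  keys :: "('n, 'f, 'x) msg set"
  keyinv :: "('n, 'f, 'x) msg \<Rightarrow> ('n, 'f, 'x) msg"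
  ids :: "'n set"
  intruder :: 'n
  eqs :: "(('n, 'f, 'x) msg \<times> ('n, 'f, 'x) msg) set"
  rules :: "(('n, 'f, 'x) msg \<times> ('n, 'f, 'x) msg) set"
  know :: "'n \<Rightarrow> ('n, 'f, 'x) msg set"
  level :: "('n, 'f, 'x) msg \<Rightarrow> 'n set option"

inductive_set messages :: "('n, 'f, 'x) verif_ctx \<Rightarrow> ('n, 'f, 'x) msg set"
  for C :: "('n, 'f, 'x) verif_ctx" where
  "Name a \<in> messages C"
| "Var x \<in> messages C"
| "Empty \<in> messages C"
| "length ts = arity C f \<Longrightarrow> \<forall>t\<in>set ts. t \<in> messages C \<Longrightarrow> Fun f ts \<in> messages C"

definition sec_bot :: "('n, 'f, 'x) verif_ctx \<Rightarrow> 'n set" where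
  "sec_bot C = ids C"

text \<open>One replacement, inside a message, of an instance of the left side of a pair in \<open>E\<close> by the
  corresponding instance of its right side.\<close>

inductive replace_step ::
    "('n, 'f, 'x) verif_ctx \<Rightarrow> (('n, 'f, 'x) msg \<times> ('n, 'f, 'x) msg) set
      \<Rightarrow> ('n, 'f, 'x) msg \<Rightarrow> ('n, 'f, 'x) msg \<Rightarrow> bool"
  for C :: "('n, 'f, 'x) verif_ctx" and E where
  root: "(l, r) \<in> E \<Longrightarrow> \<forall>x. \<theta> x \<in> messages C \<Longrightarrow> replace_step C E (subst \<theta> l) (subst \<theta> r)"
| arg: "replace_step C E s t \<Longrightarrow> length (us @ s # vs) = arity C f
    \<Longrightarrow> \<forall>u\<in>set us \<union> set vs. u \<in> messages C
    \<Longrightarrow> replace_step C E (Fun f (us @ s # vs)) (Fun f (us @ t # vs))"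

definition eq_theory :: "('n, 'f, 'x) verif_ctx \<Rightarrow> ('n, 'f, 'x) msg \<Rightarrow> ('n, 'f, 'x) msg \<Rightarrow> bool" where
  "eq_theory C = equivclp (replace_step C (eqs C))"

definition is_normal_form_of ::
    "('n, 'f, 'x) verif_ctx \<Rightarrow> ('n, 'f, 'x) msg \<Rightarrow> ('n, 'f, 'x) msg \<Rightarrow> bool" where
  "is_normal_form_of C n m \<longleftrightarrow>
     (replace_step C (rules C))\<^sup>*\<^sup>* m n \<and> (\<nexists>n'. replace_step C (rules C) n n')"

definition nf :: "('n, 'f, 'x) verif_ctx \<Rightarrow> ('n, 'f, 'x) msg \<Rightarrow> ('n, 'f, 'x) msg" where
  "nf C m = (THE n. is_normal_form_of C n m)"

definition verif_context :: "('n, 'f, 'x) verif_ctx \<Rightarrow> bool" where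
  "verif_context C \<longleftrightarrow>
     (\<forall>f\<in>encs C. 1 \<le> arity C f) \<and>
     keys C \<subseteq> range Name \<and>
     (\<forall>k\<in>keys C. keyinv C k \<in> keys C \<and> keyinv C (keyinv C k) = k) \<and>
     intruder C \<in> ids C \<and>
     eqs C \<subseteq> messages C \<times> messages C \<and>
     rules C \<union> (rules C)\<inverse> = eqs C \<union> (eqs C)\<inverse> \<and>
     (\<forall>m\<in>messages C. \<exists>!n. is_normal_form_of C n m) \<and>
     (\<forall>a\<in>ids C. know C a \<subseteq> messages C) \<and>
     (\<forall>m l. level C m = Some l \<longrightarrow> l \<subseteq> ids C)"

inductive infers :: "('n, 'f, 'x) verif_ctx \<Rightarrow> ('n, 'f, 'x) msg set \<Rightarrow> ('n, 'f, 'x) msg \<Rightarrow> bool"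
  for C :: "('n, 'f, 'x) verif_ctx" and M where
  known: "m \<in> M \<union> know C (intruder C) \<Longrightarrow> infers C M m"
| apply_fun: "length ts = arity C f \<Longrightarrow> \<forall>t\<in>set ts. infers C M t \<Longrightarrow> infers C M (Fun f ts)"
| modulo: "infers C M m \<Longrightarrow> eq_theory C m m' \<Longrightarrow> infers C M m'"

text \<open>A comparison that involves an undefined level does not hold.\<close>

definition level_geq :: "('n, 'f, 'x) verif_ctx \<Rightarrow> ('n, 'f, 'x) msg \<Rightarrow> ('n, 'f, 'x) msg \<Rightarrow> bool" where
  "level_geq C m m' \<longleftrightarrow> (\<exists>l l'. level C m = Some l \<and> level C m' = Some l' \<and> l \<sqsupseteq>\<^sub>s l')"

definition level_set_geq ::
    "('n, 'f, 'x) verif_ctx \<Rightarrow> ('n, 'f, 'x) msg set \<Rightarrow> ('n, 'f, 'x) msg \<Rightarrow> bool" where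
  "level_set_geq C M m \<longleftrightarrow> (\<exists>m'\<in>M. level_geq C m' m)"


section \<open>Reliable functions\<close>

text \<open>Functions \<open>F\<close> (and selections \<open>S\<close>) act on an atom and a set of messages; \<open>F(\<alpha>, m)\<close> is
  \<open>F \<alpha> {m}\<close>.\<close>

type_synonym ('n, 'f, 'x) sec_fun = "('n, 'f, 'x) msg \<Rightarrow> ('n, 'f, 'x) msg set \<Rightarrow> 'n set"

type_synonym ('n, 'f, 'x) selection =
  "('n, 'f, 'x) msg \<Rightarrow> ('n, 'f, 'x) msg set \<Rightarrow> ('n, 'f, 'x) msg set"

definition well_formed :: "('n, 'f, 'x) verif_ctx \<Rightarrow> ('n, 'f, 'x) sec_fun \<Rightarrow> bool" where
  "well_formed C F \<longleftrightarrow>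
     (\<forall>\<alpha>\<in>atomics.
        (\<forall>M\<subseteq>messages C. F \<alpha> M \<subseteq> ids C) \<and>
        F \<alpha> {\<alpha>} = sec_bot C \<and>
        (\<forall>M1\<subseteq>messages C. \<forall>M2\<subseteq>messages C. F \<alpha> (M1 \<union> M2) = sec_meet {F \<alpha> M1, F \<alpha> M2}) \<and>
        (\<forall>M\<subseteq>messages C. \<alpha> \<notin> atoms_of M \<longrightarrow> F \<alpha> M = sec_top))"

definition full_invariant_by_intruder ::
    "('n, 'f, 'x) verif_ctx \<Rightarrow> ('n, 'f, 'x) sec_fun \<Rightarrow> bool" where
  "full_invariant_by_intruder C F \<longleftrightarrow>
     (\<forall>M\<subseteq>messages C. \<forall>m\<in>messages C. infers C M m \<longrightarrow>
        (\<forall>\<alpha>\<in>atoms m. F \<alpha> {m} \<sqsupseteq>\<^sub>s F \<alpha> M \<or> level_set_geq C (know C (intruder C)) \<alpha>))"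

definition reliable :: "('n, 'f, 'x) verif_ctx \<Rightarrow> ('n, 'f, 'x) sec_fun \<Rightarrow> bool" where
  "reliable C F \<longleftrightarrow> well_formed C F \<and> full_invariant_by_intruder C F"


section \<open>Selections inside the protection of an external key\<close>

text \<open>When the key position does not hold a key (for instance because a variable there has been
  erased), there is no reverse key, and the encryption gives no protection.\<close>

definition key_protects ::
    "('n, 'f, 'x) verif_ctx \<Rightarrow> ('n, 'f, 'x) msg \<Rightarrow> ('n, 'f, 'x) msg \<Rightarrow> bool" where
  "key_protects C k \<alpha> \<longleftrightarrow> k \<in> keys C \<and> level_geq C (keyinv C k) \<alpha>"

definition S_Gen_EK :: "('n, 'f, 'x) verif_ctx \<Rightarrow> ('n, 'f, 'x) selection set" where
  "S_Gen_EK C = {S.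
     (\<forall>\<alpha>\<in>atomics.
        (\<forall>M\<subseteq>messages C. S \<alpha> M \<subseteq> atomics) \<and>
        S \<alpha> {\<alpha>} = atomics \<and>
        (\<forall>m\<in>messages C. \<alpha> \<notin> atoms m \<longrightarrow> S \<alpha> {m} = {}) \<and>
        (\<forall>f k ms. let m = Fun f (k # ms) in
           m \<in> messages C \<and> \<alpha> \<in> atoms m \<and> m = nf C m \<and> f \<in> encs C \<and> key_protects C k \<alpha> \<longrightarrow>
           S \<alpha> {m} \<subseteq> (atoms_of (set ms) \<union> {keyinv C k}) - {\<alpha>}) \<and>
        (\<forall>f k ms. let m = Fun f (k # ms) in
           m \<in> messages C \<and> \<alpha> \<in> atoms m \<and> m = nf C m \<and> f \<in> encs C \<and> \<not> key_protects C k \<alpha> \<longrightarrow>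
           S \<alpha> {m} = (\<Union>m'\<in>set ms. S \<alpha> {m'})) \<and>
        (\<forall>f ms. let m = Fun f ms in
           m \<in> messages C \<and> \<alpha> \<in> atoms m \<and> m = nf C m \<and> f \<notin> encs C \<longrightarrow>
           S \<alpha> {m} = (\<Union>m'\<in>set ms. S \<alpha> {m'})) \<and>
        (\<forall>m\<in>messages C. \<alpha> \<in> atoms m \<and> m \<noteq> nf C m \<longrightarrow> S \<alpha> {m} = S \<alpha> {nf C m}) \<and>
        (\<forall>m\<in>messages C. \<forall>M\<subseteq>messages C. S \<alpha> ({m} \<union> M) = S \<alpha> {m} \<union> S \<alpha> M))}"

text \<open>\<open>psi_atom\<close> is partial since \<open>level\<close> is; \<open>psi\<close> is the meet of the defined values.\<close>

definition psi_atom :: "('n, 'f, 'x) verif_ctx \<Rightarrow> ('n, 'f, 'x) msg \<Rightarrow> 'n set option" where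
  "psi_atom C \<beta> =
     (case \<beta> of Name a \<Rightarrow> (if a \<in> ids C then Some {a} else level C \<beta>) | _ \<Rightarrow> level C \<beta>)"

definition psi :: "('n, 'f, 'x) verif_ctx \<Rightarrow> ('n, 'f, 'x) msg set \<Rightarrow> 'n set" where
  "psi C B = (if B = {} then sec_top else sec_meet {l. \<exists>\<beta>\<in>B. psi_atom C \<beta> = Some l})"

definition has_selection ::
    "('n, 'f, 'x) verif_ctx \<Rightarrow> ('n, 'f, 'x) sec_fun \<Rightarrow> ('n, 'f, 'x) selection \<Rightarrow> bool" where
  "has_selection C F S \<longleftrightarrow> (\<forall>\<alpha>\<in>atomics. \<forall>M\<subseteq>messages C. F \<alpha> M = psi C (S \<alpha> M))"


section \<open>Protocols\<close>

text \<open>A protocol consists of its generalized roles, each with the agent who executes it, and of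
  the renaming \<open>apart t\<close> applied to each message \<open>t\<close> of these roles so that distinct messages
  share no variable.\<close>

datatype ('n, 'f, 'x) action =
    Send (payload: "('n, 'f, 'x) msg")
  | Receive (payload: "('n, 'f, 'x) msg")

record ('n, 'f, 'x) proto =
  gen_roles :: "('n \<times> ('n, 'f, 'x) action list) set"
  apart :: "('n, 'f, 'x) msg \<Rightarrow> 'x \<Rightarrow> 'x"

definition role_msgs :: "('n, 'f, 'x) proto \<Rightarrow> ('n, 'f, 'x) msg set" where
  "role_msgs p = (\<Union>(a, steps)\<in>gen_roles p. payload ` set steps)"

definition gen_msgs :: "('n, 'f, 'x) proto \<Rightarrow> ('n, 'f, 'x) msg set" where
  "gen_msgs p = (\<lambda>t. subst (\<lambda>x. Var (apart p t x)) t) ` role_msgs p"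

definition protocol :: "('n, 'f, 'x) verif_ctx \<Rightarrow> ('n, 'f, 'x) proto \<Rightarrow> bool" where
  "protocol C p \<longleftrightarrow>
     finite (gen_roles p) \<and>
     (\<forall>(a, steps)\<in>gen_roles p. a \<in> ids C \<and> a \<noteq> intruder C) \<and>
     role_msgs p \<subseteq> messages C \<and>
     (\<forall>t\<in>role_msgs p. inj_on (apart p t) (vars t)) \<and>
     (\<forall>t\<in>role_msgs p. \<forall>t'\<in>role_msgs p. t \<noteq> t' \<longrightarrow> apart p t ` vars t \<inter> apart p t' ` vars t' = {})"

definition substs :: "('n, 'f, 'x) verif_ctx \<Rightarrow> ('x \<Rightarrow> ('n, 'f, 'x) msg) set" where
  "substs C = {\<sigma>. \<forall>x. \<sigma> x \<in> messages C \<and> closed_msg (\<sigma> x)}"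

definition closed_msgs :: "('n, 'f, 'x) verif_ctx \<Rightarrow> ('n, 'f, 'x) proto \<Rightarrow> ('n, 'f, 'x) msg set" where
  "closed_msgs C p = {subst \<sigma> m | m \<sigma>. m \<in> gen_msgs p \<and> \<sigma> \<in> substs C}"


section \<open>Derivation and Witness-Functions\<close>

primrec erase :: "'x set \<Rightarrow> ('n, 'f, 'x) msg \<Rightarrow> ('n, 'f, 'x) msg" where
  "erase V (Name a) = Name a"
| "erase V (Var x) = (if x \<in> V then Empty else Var x)"
| "erase V Empty = Empty"
| "erase V (Fun f ts) = Fun f (map (erase V) ts)"

lemma erase_Un: "erase (V \<union> W) m = erase V (erase W m)"
  by (induction m) auto

definition deriv_all :: "('n, 'f, 'x) msg \<Rightarrow> ('n, 'f, 'x) msg" where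
  "deriv_all m = erase (vars m) m"

definition deriv_except :: "'x \<Rightarrow> ('n, 'f, 'x) msg \<Rightarrow> ('n, 'f, 'x) msg" where
  "deriv_except x m = erase (vars m - {x}) m"

text \<open>\<open>F(\<alpha>, \<partial>[\<alpha>]m\<sigma>)\<close>.  If \<open>\<alpha>\<close> comes from the substitution of several variables of \<open>m\<close>, the second
  case of the definition yields one value for each of them, and their meet is taken.\<close>

definition deriv_val ::
    "('n, 'f, 'x) sec_fun \<Rightarrow> ('n, 'f, 'x) msg \<Rightarrow> ('n, 'f, 'x) msg
      \<Rightarrow> ('x \<Rightarrow> ('n, 'f, 'x) msg) \<Rightarrow> 'n set" where
  "deriv_val F \<alpha> m \<sigma> =
     (if \<alpha> \<notin> atoms (subst \<sigma> m) then sec_top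
      else if \<alpha> \<in> atoms (deriv_all m) then F \<alpha> {deriv_all m}
      else sec_meet {F (Var x) {deriv_except x m} | x. x \<in> vars m \<and> \<alpha> \<in> atoms (\<sigma> x)})"

definition witness ::
    "('n, 'f, 'x) verif_ctx \<Rightarrow> ('n, 'f, 'x) proto \<Rightarrow> ('n, 'f, 'x) sec_fun
      \<Rightarrow> ('n, 'f, 'x) msg \<Rightarrow> ('n, 'f, 'x) msg \<Rightarrow> 'n set" where
  "witness C p F \<alpha> t =
     sec_meet {deriv_val F \<alpha> m' \<sigma>' | m' \<sigma>'.
       m' \<in> gen_msgs p \<and> \<sigma>' \<in> substs C \<and> subst \<sigma>' m' = t}"

end

(* A source m' of the closed message m\<sigma>, with substitution \<sigma>', is either m itself or, by the renaming
   apart, shares no variable with m.  In both cases a single substitution acts as \<sigma>' on m' and unifies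
   m' with m, and the derived value depends only on the substitution of the variables of m'. *)

theory Submission
  imports Defs
begin

lemma subst_cong:
  assumes "\<And>x. x \<in> vars m \<Longrightarrow> \<sigma> x = \<tau> x"
  shows "subst \<sigma> m = subst \<tau> m"
  using assms by (induction m) auto

lemma vars_subst_rename: "vars (subst (\<lambda>x. Var (h x)) t) = h ` vars t"
  by (induction t) auto

text \<open>The substitution enters \<open>deriv_val\<close> only through
  \<open>subst \<sigma> m\<close> and through the values \<open>\<sigma> x\<close> at variables of
  \<open>m\<close>; the derived messages do not involve it.\<close>

lemma deriv_val_cong:
  assumes "\<And>x. x \<in> vars m \<Longrightarrow> \<sigma> x = \<tau> x"
  shows "deriv_val F \<alpha> m \<sigma> = deriv_val F \<alpha> m \<tau>"
proof -
  have "{F (Var x) {deriv_except x m} | x. x \<in> vars m \<and> \<alpha> \<in> atoms (\<sigma> x)}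
      = {F (Var x) {deriv_except x m} | x. x \<in> vars m \<and> \<alpha> \<in> atoms (\<tau> x)}"
    using assms by metis
  then show ?thesis
    using subst_cong[OF assms] by (simp add: deriv_val_def)
qed

text \<open>Each generalized message is determined by the role message it renames, so distinct ones
  have distinct originals, and \<open>apart\<close> gives these disjoint variables.\<close>

lemma gen_msgs_vars_disjoint:
  assumes "protocol C p" "m \<in> gen_msgs p" "m' \<in> gen_msgs p" "m \<noteq> m'"
  shows "vars m \<inter> vars m' = {}"
proof -
  obtain t t' where t: "t \<in> role_msgs p" "m = subst (\<lambda>x. Var (apart p t x)) t"
    and t': "t' \<in> role_msgs p" "m' = subst (\<lambda>x. Var (apart p t' x)) t'"
    using assms(2,3) by (auto simp: gen_msgs_def)
  with \<open>m \<noteq> m'\<close> have "t \<noteq> t'" by blast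
  with assms(1) t t' show ?thesis
    unfolding protocol_def by (simp add: vars_subst_rename)
qed

lemma source_unifiable:
  assumes "protocol C p" "m \<in> gen_msgs p" "m' \<in> gen_msgs p"
    and "\<sigma> \<in> substs C" "\<sigma>' \<in> substs C" "subst \<sigma>' m' = subst \<sigma> m"
  obtains \<tau> where "\<tau> \<in> substs C" "subst \<tau> m' = subst \<tau> m" "\<And>x. x \<in> vars m' \<Longrightarrow> \<tau> x = \<sigma>' x"
proof (cases "m = m'")
  case True
  \<comment> \<open>Here \<open>\<sigma>'\<close> itself serves as \<open>\<tau>\<close>: the
    unification is trivial.\<close>
  with assms(5) that show ?thesis by blast
next
  case False
  \<comment> \<open>Gluing: disjointness of variables makes \<open>\<tau>\<close> act as
    \<open>\<sigma>\<close> on \<open>m\<close>, so both images are the given closed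
    message.\<close>
  define \<tau> where "\<tau> = (\<lambda>x. if x \<in> vars m' then \<sigma>' x else \<sigma> x)"
  have "\<tau> \<in> substs C"
    using assms(4,5) by (simp add: \<tau>_def substs_def)
  moreover have "subst \<tau> m' = subst \<sigma>' m'"
    by (rule subst_cong) (simp add: \<tau>_def)
  moreover have "subst \<tau> m = subst \<sigma> m"
    using gen_msgs_vars_disjoint[OF assms(1-3) False]
    by (intro subst_cong) (auto simp: \<tau>_def)
  ultimately show ?thesis
    using that[of \<tau>] assms(6) by (simp add: \<tau>_def)
qed

theorem lemma6p4:
  fixes C :: "('n, 'f, 'x) verif_ctx"
    and p :: "('n, 'f, 'x) proto"
    and F :: "('n, 'f, 'x) sec_fun"
    and S :: "('n, 'f, 'x) selection"
    and m :: "('n, 'f, 'x) msg"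
  assumes "verif_context C"
    and "protocol C p"
    and "reliable C F"
    and "S \<in> S_Gen_EK C"
    and "has_selection C F S"
    and "m \<in> gen_msgs p"
  shows "\<forall>\<sigma>\<in>substs C. \<forall>\<alpha>\<in>atoms_of (closed_msgs C p).
           deriv_val F \<alpha> m \<sigma> \<sqsupseteq>\<^sub>s witness C p F \<alpha> (subst \<sigma> m) \<and>
           witness C p F \<alpha> (subst \<sigma> m) \<sqsupseteq>\<^sub>s
             sec_meet {deriv_val F \<alpha> m' \<sigma>' | m' \<sigma>'.
               m' \<in> gen_msgs p \<and> \<sigma>' \<in> substs C \<and> subst \<sigma>' m' = subst \<sigma>' m}"
proof (intro ballI conjI)
  fix \<sigma> \<alpha>
  assume \<sigma>: "\<sigma> \<in> substs C"
  show "deriv_val F \<alpha> m \<sigma> \<sqsupseteq>\<^sub>s witness C p F \<alpha> (subst \<sigma> m)"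
    \<comment> \<open>The pair of \<open>m\<close> and \<open>\<sigma>\<close> is one of the sources
      over which the meet, a union, is taken.\<close>
    using \<sigma> \<open>m \<in> gen_msgs p\<close> unfolding witness_def sec_geq_def sec_meet_def by blast
  \<comment> \<open>Every value in the meet of the witness reappears in the meet of the lower bound,
    under a possibly different substitution; a meet over more values is less secure.\<close>
  have "\<exists>\<tau>. deriv_val F \<alpha> m' \<sigma>' = deriv_val F \<alpha> m' \<tau> \<and> \<tau> \<in> substs C \<and> subst \<tau> m' = subst \<tau> m"
    if src: "m' \<in> gen_msgs p" "\<sigma>' \<in> substs C" "subst \<sigma>' m' = subst \<sigma> m" for m' \<sigma>'
  proof -
    obtain \<tau> where "\<tau> \<in> substs C" "subst \<tau> m' = subst \<tau> m" "\<And>x. x \<in> vars m' \<Longrightarrow> \<tau> x = \<sigma>' x"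
      using source_unifiable[OF \<open>protocol C p\<close> \<open>m \<in> gen_msgs p\<close> src(1) \<sigma> src(2,3)] by blast
    then show ?thesis
      using deriv_val_cong[of m' \<sigma>' \<tau> F \<alpha>] by auto
  qed
  then show "witness C p F \<alpha> (subst \<sigma> m) \<sqsupseteq>\<^sub>s
      sec_meet {deriv_val F \<alpha> m' \<sigma>' | m' \<sigma>'.
        m' \<in> gen_msgs p \<and> \<sigma>' \<in> substs C \<and> subst \<sigma>' m' = subst \<sigma>' m}"
    unfolding witness_def sec_geq_def sec_meet_def by (intro Union_mono) blast
qed

end
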